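(* Let $A$ be a bounded subset of $\mathbb{R}^d$ such that $$0<\underline{\mathcal{M}}(h;A)\le\overline{\mathcal{M}}(h;A)<\infty$$ for some gauge function $h:(0,\infty)\to(0,\infty)$, $h(r)=r^{d-D} g(r)$, with $D\in[0,d)$ and $g:(0,\infty)\to(0,\infty)$ non-decreasing. Then $$0<\underline{\mathcal{S}}(r^{-1}h; A)\le\overline{\mathcal{S}}(r^{-1}h;A)<\infty .$$ If additionally $g$ is differentiable and $\limsup_{r\to 0}\frac {r g'(r)}{g(r)}<\infty$, then $$0<\underline{\mathcal{S}}(h'; A)\le\overline{\mathcal{S}}(h';A)<\infty .$$
   Context: Let $d\ge 1$ be an integer and $A\subset\mathbb{R}^d$ bounded. For $r>0$ let $A_r:=\{z\in\mathbb{R}^d: d_A(z)\le r\}$ be the $r$-parallel set, where $d_A$ is the Euclidean distance function of $A$. Let $\mathcal{H}^t$ denote $t$-dimensional Hausdorff measure, $V_A(r):=\mathcal{H}^d(A_r)$ and $S_A(r):=\mathcal{H}^{d-1}(\partial A_r)$. A gauge function is a continuous function $h:(0,\infty)\to(0,\infty)$. The lower and upper generalized Minkowski contents of $A$ with respect to $h$ are $$\underline{\mathcal{M}}(h;A):=\liminf_{r\to0}\frac{V_A(r)}{h(r)},\qquad \overline{\mathcal{M}}(h;A):=\limsup_{r\to0}\frac{V_A(r)}{h(r)},$$ and the lower and upper generalized S-contents with respect to $h$ are $$\underline{\mathcal{S}}(h;A):=\liminf_{r\to0}\frac{S_A(r)}{h(r)},\qquad \overline{\mathcal{S}}(h;A):=\limsup_{r\to0}\frac{S_A(r)}{h(r)}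 .$$ Here $\underline{\mathcal{S}}(r^{-1}h;A)$, $\overline{\mathcal{S}}(r^{-1}h;A)$ mean these expressions with the function $r\mapsto r^{-1}h(r)$ in place of $h$, and $\underline{\mathcal{S}}(h';A)$, $\overline{\mathcal{S}}(h';A)$ mean them with the derivative $h'$ in place of $h$ (no continuity of $h'$ is required). *)

theory Defs
  imports "HOL-Analysis.Analysis"
begin

text \<open>
  Hausdorff measure as an outer measure on all subsets, normalised by the factor
  \<open>unit_ball_vol t / 2 powr t\<close>, so that for \<open>t = DIM('a)\<close> it is Lebesgue measure.
  The case \<open>t = 0\<close> (counting measure) is separated because \<open>0 powr 0 = 0\<close> in the library,
  so singletons would otherwise get weight \<open>0\<close>.
\<close>

definition hausdorff_weight :: "real \<Rightarrow> 'a::metric_space set \<Rightarrow> ennreal" where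
  "hausdorff_weight t U =
     (if U = {} then 0
      else if t = 0 then 1
      else ennreal (unit_ball_vol t * (diameter U / 2) powr t))"

text \<open>Covering sets are required to be bounded because the library's real-valued
  \<open>diameter\<close> is meaningless on unbounded sets.  Finite covers are included
  by padding with the empty set.\<close>

definition hausdorff_premeasure :: "real \<Rightarrow> real \<Rightarrow> 'a::metric_space set \<Rightarrow> ennreal" where
  "hausdorff_premeasure t \<delta> E =
     (INF U \<in> {U :: nat \<Rightarrow> 'a set. E \<subseteq> (\<Union>i. U i) \<and> (\<forall>i. bounded (U i) \<and> diameter (U i) \<le> \<delta>)}.
        (\<Sum>i. hausdorff_weight t (U i)))"

definition hausdorff_measure :: "real \<Rightarrow> 'a::metric_space set \<Rightarrow> ennreal" where
  "hausdorff_measure t E = (SUP \<delta> \<in> {0<..}. hausdorff_premeasure t \<delta> E)"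

text \<open>The distance to the empty set is \<open>\<infinity>\<close>, whereas \<open>infdist z {} = 0\<close> in the library;
  hence the guard.\<close>

definition parallel_set :: "'a::metric_space set \<Rightarrow> real \<Rightarrow> 'a set" where
  "parallel_set A r = {z. A \<noteq> {} \<and> infdist z A \<le> r}"

definition parallel_volume :: "'a::euclidean_space set \<Rightarrow> real \<Rightarrow> ennreal" where
  "parallel_volume A r = hausdorff_measure (real DIM('a)) (parallel_set A r)"

definition parallel_surface :: "'a::euclidean_space set \<Rightarrow> real \<Rightarrow> ennreal" where
  "parallel_surface A r = hausdorff_measure (real DIM('a) - 1) (frontier (parallel_set A r))"

text \<open>Functions on \<open>(0,\<infinity>)\<close> are total functions on the reals of which only the values at
  positive arguments matter.\<close>

definition gauge_function :: "(real \<Rightarrow> real) \<Rightarrow> bool" where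
  "gauge_function h \<longleftrightarrow> continuous_on {0<..} h \<and> (\<forall>r>0. h r > 0)"

text \<open>The contents are defined for an arbitrary real function in the denominator, since they are
  also used with the derivative of a gauge function.  The quotients are formed in \<^typ>\<open>ereal\<close>
  so that no value of that function is truncated.\<close>

definition lower_Minkowski_content :: "(real \<Rightarrow> real) \<Rightarrow> 'a::euclidean_space set \<Rightarrow> ereal" where
  "lower_Minkowski_content h A =
     Liminf (at_right 0) (\<lambda>r. enn2ereal (parallel_volume A r) / ereal (h r))"

definition upper_Minkowski_content :: "(real \<Rightarrow> real) \<Rightarrow> 'a::euclidean_space set \<Rightarrow> ereal" where
  "upper_Minkowski_content h A =
     Limsup (at_right 0) (\<lambda>r. enn2ereal (parallel_volume A r) / ereal (h r))"

definition lower_S_content :: "(real \<Rightarrow> real) \<Rightarrow> 'a::euclidean_space set \<Rightarrow> ereal" where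
  "lower_S_content h A =
     Liminf (at_right 0) (\<lambda>r. enn2ereal (parallel_surface A r) / ereal (h r))"

definition upper_S_content :: "(real \<Rightarrow> real) \<Rightarrow> 'a::euclidean_space set \<Rightarrow> ereal" where
  "upper_S_content h A =
     Limsup (at_right 0) (\<lambda>r. enn2ereal (parallel_surface A r) / ereal (h r))"

end

theory Submission
  imports Defs
begin

text \<open>Constants do not matter, so Hausdorff measure of top dimension may be traded for Lebesgue
  measure; write \<open>V r\<close> for the Lebesgue measure of the parallel set of radius \<open>r\<close>, \<open>S r\<close> for
  the surface area and \<open>d\<close> for the dimension. The hypotheses then say that \<open>V r\<close> lies between
  two positive multiples of \<open>h r\<close> for small \<open>r\<close>, and \<open>S r\<close> has to be compared with \<open>h r / r\<close>. This
  follows from two inequalities that hold for every radius.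

  Upper bound: \<open>S r \<le> K * V r / r\<close>. The volume satisfies \<open>V s \<le> (s/r)^d * V r\<close> for \<open>r \<le> s\<close>
  (\<open>measure_parallel_set_scale\<close>), because shrinking Voronoi cells about their centres keeps
  them disjoint. So an annulus of width \<open>e\<close> around radius \<open>r\<close> has volume of order at most
  \<open>(e/r) * V r\<close>. It contains a neighbourhood of the boundary, and a packing argument
  (\<open>hausdorff_premeasure_le_measure\<close>) converts this into a bound for the Hausdorff measure of the
  boundary (\<open>parallel_surface_le\<close>).

  Lower bound: \<open>V (c * r) - V r \<le> K * r * S r\<close>, with \<open>K\<close> depending on \<open>c\<close> only
  (\<open>volume_increment_le_surface\<close>). The segment from a point of the annulus to a nearest point
  of \<open>A\<close> meets the boundary of the parallel set, and the resulting map has a Lipschitz inverse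
  on each level set of the distance (\<open>dist_le_ray_points\<close>). Covers of the boundary
  therefore lift to covers of the annulus with comparable cost. Since \<open>g\<close> is monotone,
  \<open>h (c * r) \<ge> c powr (d - D) * h r\<close>, and \<open>D < d\<close> allows \<open>c\<close> to be chosen such that
  \<open>V (c * r)\<close> exceeds \<open>V r\<close> by a fixed multiple of \<open>h r\<close>.

  The statement about the derivative follows because \<open>deriv h r\<close> lies between
  \<open>(d - D) * h r / r\<close> and a larger multiple of \<open>h r / r\<close>.\<close>

section \<open>Parallel sets\<close>

lemma infdist_closure [simp]: "infdist z (closure A) = infdist z A"
  for A :: "'a::euclidean_space set"
  by (simp add: infdist_eq_setdist)

lemma parallel_set_closure: "parallel_set (closure A) r = parallel_set A r"
  for A :: "'a::euclidean_space set"
  by (simp add: parallel_set_def)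

lemma compact_parallel_set:
  fixes A :: "'a::euclidean_space set"
  assumes "bounded A"
  shows "compact (parallel_set A r)"
proof (cases "A = {}")
  case False
  have "closed (parallel_set A r)"
    using False by (auto simp: parallel_set_def intro!: closed_Collect_le continuous_intros)
  moreover have "compact {z. infdist z (closure A) \<le> max r 1}"
    using compact_infdist_le[of "closure A" "max r 1"] assms False by (simp add: compact_closure)
  moreover have "parallel_set A r \<subseteq> {z. infdist z (closure A) \<le> max r 1}"
    by (auto simp: parallel_set_def)
  ultimately show ?thesis
    by (metis compact_Int_closed inf.absorb_iff2)
qed (simp add: parallel_set_def)

lemma lmeasurable_parallel_set:
  "bounded A \<Longrightarrow> parallel_set A r \<in> lmeasurable" for A :: "'a::euclidean_space set"
  by (simp add: compact_parallel_set lmeasurable_compact)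

lemma parallel_set_mono: "r \<le> s \<Longrightarrow> parallel_set A r \<subseteq> parallel_set A s"
  by (auto simp: parallel_set_def)

lemma measure_lebesgue_cball:
  "0 \<le> r \<Longrightarrow> measure lebesgue (cball c r) = unit_ball_vol (real DIM('a)) * r ^ DIM('a)"
  for c :: "'a::euclidean_space"
  by (simp add: content_cball)

section \<open>Nearest points and Voronoi cells\<close>

text \<open>A choice of nearest points is a monotone map in the sense of convex analysis, for an arbitrary
  set of candidates: adding the squared hypotheses cancels all terms except the mixed ones.\<close>

lemma nearest_points_monotone:
  fixes z w p q :: "'a::real_inner"
  assumes "dist z p \<le> dist z q" and "dist w q \<le> dist w p"
  shows "0 \<le> (z - w) \<bullet> (p - q)"
  using assms by (simp add: dist_norm norm_le inner_diff_left inner_diff_right inner_commute)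

text \<open>Voronoi cells are star-shaped about their centre, and moving a point of a closed cell towards
  the centre puts it strictly inside. This separates shrunken cells that had common faces.\<close>

lemma nearest_point_strict_contract:
  fixes z a b :: "'a::real_inner"
  assumes "dist z a \<le> dist z b" and "a \<noteq> b" and "0 \<le> t" and "t < 1"
  shows "dist (a + t *\<^sub>R (z - a)) a < dist (a + t *\<^sub>R (z - a)) b"
proof -
  define u v where "u = z - a" and "v = b - a"
  have [simp]: "v \<noteq> 0"
    using assms by (simp add: v_def)
  have "norm u \<le> norm (u - v)"
    using assms by (simp add: u_def v_def dist_norm)
  then have "2 * (u \<bullet> v) \<le> v \<bullet> v"
    by (simp add: norm_le inner_diff_left inner_diff_right inner_commute)
  then have "t * (2 * (u \<bullet> v)) \<le> t * (v \<bullet> v)"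
    by (rule mult_left_mono) (fact assms)
  also have "\<dots> < v \<bullet> v"
    using assms by simp
  finally have "norm (t *\<^sub>R u) < norm (t *\<^sub>R u - v)"
    unfolding norm_lt by (simp add: inner_diff_left inner_diff_right inner_commute)
  then show ?thesis
    by (simp add: u_def v_def dist_norm algebra_simps)
qed

lemma lmeasurable_Union_cball:
  "finite F \<Longrightarrow> (\<Union>a\<in>F. cball a r) \<in> lmeasurable" for F :: "'a::euclidean_space set"
  by (simp add: compact_UN lmeasurable_compact)

text \<open>The Voronoi cells of \<open>F\<close> cut the union of the large balls into pieces, one for each centre.
  Shrinking each piece by the factor \<open>1/c\<close> about its own centre puts it into the small ball with
  that centre, and the shrunken pieces are disjoint, so the small balls cover at least
  \<open>c\<close> to the power \<open>- DIM('a)\<close> times the volume of the large ones.\<close>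

lemma finite_ball_union_scale:
  fixes F :: "'a::euclidean_space set"
  assumes "finite F" and "0 \<le> r" and "1 \<le> c"
  shows "measure lebesgue (\<Union>a\<in>F. cball a (c * r))
       \<le> c ^ DIM('a) * measure lebesgue (\<Union>a\<in>F. cball a r)"
proof (cases "c = 1")
  case False
  then have c: "1 < c"
    using assms by simp
  \<comment> \<open>\<open>C a\<close> is the piece of the cell of \<open>a\<close> in the large ball, \<open>f a\<close> shrinks it about \<open>a\<close>.\<close>
  define C where "C a = cball a (c * r) \<inter> (\<Inter>b\<in>F. {z. dist z a \<le> dist z b})" for a
  define f where "f a z = inverse c *\<^sub>R z + (1 - inverse c) *\<^sub>R a" for a z :: 'a
  have f_alt: "f a z = a + inverse c *\<^sub>R (z - a)" for a z
    by (simp add: f_def algebra_simps)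
  have C_compact: "compact (C a)" for a
    unfolding C_def by (intro compact_Int_closed compact_cball closed_INT ballI closed_Collect_le continuous_intros)
  have f_compact: "compact (f a ` C a)" for a
    by (intro compact_continuous_image C_compact) (auto simp: f_def intro!: continuous_intros)
  have f_sub: "f a ` C a \<subseteq> cball a r" for a
  proof
    fix w assume "w \<in> f a ` C a"
    then obtain z where z: "z \<in> C a" "w = f a z"
      by auto
    then have "dist a w = inverse c * norm (z - a)"
      using c by (simp add: f_alt dist_norm)
    also have "\<dots> \<le> inverse c * (c * r)"
      using z c by (intro mult_left_mono) (auto simp: C_def dist_norm norm_minus_commute)
    also have "\<dots> = r"
      using c by simp
    finally show "w \<in> cball a r"
      by simp
  qed
  have f_disj: "disjnt (f a ` C a) (f b ` C b)" if "a \<in> F" "b \<in> F" "a \<noteq> b" for a b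
  proof -
    have *: "dist w x < dist w y" if "w \<in> f x ` C x" "y \<in> F" "x \<noteq> y" for w x y
      using that c nearest_point_strict_contract[of _ x y "inverse c"]
      by (auto simp: C_def f_alt inverse_less_1_iff)
    show ?thesis
      using *[of _ a b] *[of _ b a] that by (fastforce simp: disjnt_iff)
  qed
  have "(\<Union>a\<in>F. cball a (c * r)) \<subseteq> (\<Union>a\<in>F. C a)"
  proof
    fix z assume "z \<in> (\<Union>a\<in>F. cball a (c * r))"
    then obtain a where a: "a \<in> F" "dist a z \<le> c * r"
      by auto
    then have "F \<noteq> {}"
      by auto
    define m where "m = arg_min_on (dist z) F"
    have m: "m \<in> F" "\<And>b. b \<in> F \<Longrightarrow> dist z m \<le> dist z b"
      using \<open>F \<noteq> {}\<close> assms(1) by (auto simp: m_def arg_min_if_finite arg_min_least)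
    then have "z \<in> C m"
      using a order_trans[OF m(2)[OF a(1)], of "c * r"] by (simp add: C_def dist_commute)
    with m show "z \<in> (\<Union>a\<in>F. C a)"
      by auto
  qed
  then have "measure lebesgue (\<Union>a\<in>F. cball a (c * r)) \<le> measure lebesgue (\<Union>a\<in>F. C a)"
    by (intro measure_mono_fmeasurable fmeasurableD lmeasurable_compact compact_UN
          lmeasurable_Union_cball assms C_compact)
  also have "\<dots> \<le> (\<Sum>a\<in>F. measure lebesgue (C a))"
    by (intro measure_UNION_le assms fmeasurableD lmeasurable_compact C_compact)
  also have "\<dots> = (\<Sum>a\<in>F. c ^ DIM('a) * measure lebesgue (f a ` C a))"
  proof (rule sum.cong)
    fix a
    have "measure lebesgue (f a ` C a) = inverse c ^ DIM('a) * measure lebesgue (C a)"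
      using c measure_lebesgue_affine[of "inverse c" "(1 - inverse c) *\<^sub>R a" "C a"]
      by (simp add: f_def[abs_def])
    then show "measure lebesgue (C a) = c ^ DIM('a) * measure lebesgue (f a ` C a)"
      using c by (simp add: power_inverse)
  qed simp
  also have "\<dots> = c ^ DIM('a) * measure lebesgue (\<Union>a\<in>F. f a ` C a)"
    using f_disj
    by (subst measure_UNION')
       (auto simp: sum_distrib_left pairwise_def intro!: assms lmeasurable_compact f_compact)
  also have "\<dots> \<le> c ^ DIM('a) * measure lebesgue (\<Union>a\<in>F. cball a r)"
    using f_sub c
    by (intro mult_left_mono measure_mono_fmeasurable fmeasurableD lmeasurable_compact compact_UN
          lmeasurable_Union_cball assms f_compact UN_mono) auto
  finally show ?thesis .
qed simp

section \<open>Packings and nets\<close>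

text \<open>The balls of radius \<open>e/2\<close> about the points of \<open>F\<close> are disjoint.\<close>

lemma separated_card_le_measure:
  fixes F :: "'a::euclidean_space set"
  assumes "finite F" and "0 < e" and sep: "\<And>x y. x \<in> F \<Longrightarrow> y \<in> F \<Longrightarrow> x \<noteq> y \<Longrightarrow> e < dist x y"
    and T: "T \<in> lmeasurable" "\<And>x. x \<in> F \<Longrightarrow> cball x (e/2) \<subseteq> T"
  shows "real (card F) * (unit_ball_vol (real DIM('a)) * (e/2) ^ DIM('a)) \<le> measure lebesgue T"
proof -
  have disj: "disjnt (cball x (e/2)) (cball y (e/2))" if "x \<in> F" "y \<in> F" "x \<noteq> y" for x y
  proof -
    have False if "dist x z \<le> e/2" "dist y z \<le> e/2" for z
      using sep[OF \<open>x \<in> F\<close> \<open>y \<in> F\<close> \<open>x \<noteq> y\<close>] dist_triangle2[of x y z] that by simp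
    then show ?thesis
      by (auto simp: disjnt_iff)
  qed
  have "real (card F) * (unit_ball_vol (real DIM('a)) * (e/2) ^ DIM('a))
      = (\<Sum>x\<in>F. measure lebesgue (cball x (e/2)))"
    using \<open>0 < e\<close> by (simp add: measure_lebesgue_cball del: measure_completion)
  also have "\<dots> = measure lebesgue (\<Union>x\<in>F. cball x (e/2))"
    using assms disj
    by (intro measure_UNION'[symmetric]) (auto simp: pairwise_def)
  also have "\<dots> \<le> measure lebesgue T"
    using assms by (intro measure_mono_fmeasurable) (auto dest: subsetD)
  finally show ?thesis .
qed

text \<open>The volume bound on packings makes a separated subset of largest cardinality exist, and a
  largest one is a net: a point farther than \<open>e\<close> from it could be added.\<close>

lemma finite_separated_net:
  fixes E :: "'a::euclidean_space set"
  assumes "bounded E" and "0 < e"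
  obtains F where "F \<subseteq> E" "finite F"
    and "\<And>x y. x \<in> F \<Longrightarrow> y \<in> F \<Longrightarrow> x \<noteq> y \<Longrightarrow> e < dist x y"
    and "E \<subseteq> (\<Union>x\<in>F. cball x e)"
proof -
  define P where "P F \<longleftrightarrow> F \<subseteq> E \<and> finite F \<and> (\<forall>x\<in>F. \<forall>y\<in>F. x \<noteq> y \<longrightarrow> e < dist x y)" for F
  obtain R where R: "0 < R" "E \<subseteq> cball 0 R"
    using bounded_subset_ballD[OF assms(1), of 0] ball_subset_cball by blast
  define w where "w = unit_ball_vol (real DIM('a)) * (e/2) ^ DIM('a)"
  have w: "0 < w"
    using assms by (simp add: w_def)
  define N where "N = nat \<lceil>measure lebesgue (cball (0::'a) (R + e/2)) / w\<rceil>"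
  have "card F < Suc N" if "P F" for F
  proof -
    have "real (card F) * w \<le> measure lebesgue (cball (0::'a) (R + e/2))"
      unfolding w_def
    proof (rule separated_card_le_measure)
      fix x assume "x \<in> F"
      then have "dist 0 x \<le> R"
        using that R by (auto simp: P_def)
      then show "cball x (e/2) \<subseteq> cball 0 (R + e/2)"
        by (simp add: cball_subset_cball_iff dist_commute)
    qed (use that assms in \<open>auto simp: P_def\<close>)
    then have "real (card F) \<le> measure lebesgue (cball (0::'a) (R + e/2)) / w"
      using w by (simp add: field_simps)
    then show ?thesis
      unfolding N_def by linarith
  qed
  moreover have "P {}"
    by (simp add: P_def)
  ultimately obtain F where F: "P F" "\<And>G. P G \<Longrightarrow> card G \<le> card F"
    using ex_has_greatest_nat[of P "{}" card "Suc N"] by blast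
  have "E \<subseteq> (\<Union>x\<in>F. cball x e)"
  proof (rule ccontr)
    assume "\<not> E \<subseteq> (\<Union>x\<in>F. cball x e)"
    then obtain z where z: "z \<in> E" "\<And>x. x \<in> F \<Longrightarrow> e < dist x z"
      by force
    then have "z \<notin> F"
      using \<open>0 < e\<close> by force
    moreover have "P (insert z F)"
      using F(1) z by (auto simp: P_def dist_commute)
    ultimately show False
      using F(2)[of "insert z F"] F(1) by (simp add: P_def)
  qed
  with F(1) that show ?thesis
    by (auto simp: P_def)
qed

section \<open>Scaling the radius of a parallel set\<close>

text \<open>The bound for finite sets passes to \<open>A\<close> through \<open>e/2\<close>-nets \<open>F\<close>: enlarging the radius
  from \<open>s\<close> to \<open>s + e\<close> pays for replacing \<open>A\<close> by \<open>F\<close> on the left, and the right hand side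
  only shrinks. The exact constant \<open>(s/r) ^ DIM('a)\<close>, which tends to \<open>1\<close> as \<open>s\<close> tends to
  \<open>r\<close>, is what later gives thin annuli a volume proportional to their width.\<close>

lemma measure_parallel_set_scale:
  fixes A :: "'a::euclidean_space set"
  assumes "bounded A" and "0 < r" and "r \<le> s"
  shows "measure lebesgue (parallel_set A s) \<le> (s/r) ^ DIM('a) * measure lebesgue (parallel_set A r)"
proof (cases "A = {}")
  case False
  have *: "measure lebesgue (parallel_set A s)
         \<le> ((s + e)/r) ^ DIM('a) * measure lebesgue (parallel_set A r)" if "0 < e" for e
  proof -
    have "0 < e/2"
      using that by simp
    then obtain F where F: "F \<subseteq> A" "finite F"
      "\<And>x y. x \<in> F \<Longrightarrow> y \<in> F \<Longrightarrow> x \<noteq> y \<Longrightarrow> e/2 < dist x y" "A \<subseteq> (\<Union>x\<in>F. cball x (e/2))"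
      using finite_separated_net[OF assms(1), of "e/2" thesis] by blast
    have "parallel_set A s \<subseteq> (\<Union>a\<in>F. cball a (s + e))"
    proof
      fix z assume "z \<in> parallel_set A s"
      then have "infdist z A < s + e/2"
        using that by (simp add: parallel_set_def)
      then obtain a where a: "a \<in> A" "dist z a < s + e/2"
        using False by (auto simp: infdist_notempty cINF_less_iff)
      then obtain b where b: "b \<in> F" "dist b a \<le> e/2"
        using F by auto
      then have "dist b z \<le> s + e"
        using a dist_triangle2[of b z a] by simp
      with b show "z \<in> (\<Union>a\<in>F. cball a (s + e))"
        by auto
    qed
    then have "measure lebesgue (parallel_set A s) \<le> measure lebesgue (\<Union>a\<in>F. cball a (s + e))"
      by (intro measure_mono_fmeasurable lmeasurable_Union_cball F fmeasurableD
            lmeasurable_parallel_set assms)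
    also have "\<dots> \<le> ((s + e)/r) ^ DIM('a) * measure lebesgue (\<Union>a\<in>F. cball a r)"
      using finite_ball_union_scale[OF F(2), of r "(s + e)/r"] assms that by simp
    also have "\<dots> \<le> ((s + e)/r) ^ DIM('a) * measure lebesgue (parallel_set A r)"
    proof (intro mult_left_mono measure_mono_fmeasurable)
      show "(\<Union>a\<in>F. cball a r) \<subseteq> parallel_set A r"
        using F False by (auto simp: parallel_set_def dist_commute intro!: infdist_le2)
    qed (use F assms that in \<open>simp_all add: lmeasurable_Union_cball fmeasurableD lmeasurable_parallel_set\<close>)
    finally show ?thesis .
  qed
  have "((\<lambda>e. ((s + e)/r) ^ DIM('a) * measure lebesgue (parallel_set A r)) \<longlongrightarrow>
      ((s + 0)/r) ^ DIM('a) * measure lebesgue (parallel_set A r)) (at_right 0)"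
    using assms by (intro tendsto_intros) auto
  then have "measure lebesgue (parallel_set A s) \<le> ((s + 0)/r) ^ DIM('a) * measure lebesgue (parallel_set A r)"
    by (rule tendsto_lowerbound)
       (auto simp: * intro: eventually_mono[OF eventually_at_right_less])
  then show ?thesis
    by simp
qed (simp add: parallel_set_def)

section \<open>Hausdorff measure against Lebesgue measure\<close>

text \<open>One formula covers \<open>t = 0\<close> as well: both \<open>unit_ball_vol 0\<close> and \<open>e powr 0\<close> are \<open>1\<close>.\<close>

lemma hausdorff_weight_cball:
  fixes x :: "'a::euclidean_space"
  assumes "0 < e" and "0 \<le> t"
  shows "hausdorff_weight t (cball x e) = ennreal (unit_ball_vol t * e powr t)"
  using assms by (auto simp: hausdorff_weight_def)

text \<open>Covering \<open>E\<close> by the \<open>e\<close>-balls about an \<open>e\<close>-net costs one weight for each point of the net,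
  and the number of these points is bounded by the volume \<open>T\<close> offers to disjoint \<open>e/2\<close>-balls.
  Hausdorff measures of dimension \<open>t\<close> are thereby controlled by volumes of neighbourhoods,
  in the manner of Minkowski contents. It serves for \<open>t = DIM('a)\<close> and for \<open>t = DIM('a) - 1\<close>.\<close>

lemma hausdorff_premeasure_le_measure:
  fixes E :: "'a::euclidean_space set"
  assumes "bounded E" and "0 \<le> t" and "0 < e"
    and T: "T \<in> lmeasurable" "\<And>x. x \<in> E \<Longrightarrow> cball x (e/2) \<subseteq> T"
  shows "hausdorff_premeasure t (2 * e) E
       \<le> ennreal (unit_ball_vol t * 2 ^ DIM('a) / unit_ball_vol (real DIM('a))
                   * (e powr t / e ^ DIM('a)) * measure lebesgue T)"
proof -
  let ?d = "DIM('a)"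
  obtain F where F: "F \<subseteq> E" "finite F"
    "\<And>x y. x \<in> F \<Longrightarrow> y \<in> F \<Longrightarrow> x \<noteq> y \<Longrightarrow> e < dist x y" "E \<subseteq> (\<Union>x\<in>F. cball x e)"
    using finite_separated_net[OF assms(1,3)] by metis
  obtain f where f: "bij_betw f {0..<card F} F"
    using ex_bij_betw_nat_finite[OF F(2)] by auto
  define U where "U i = (if i < card F then cball (f i) e else {})" for i
  have "E \<subseteq> (\<Union>i. U i)"
  proof
    fix z assume "z \<in> E"
    then obtain x where x: "x \<in> F" "z \<in> cball x e"
      using F(4) by auto
    then obtain i where "i < card F" "x = f i"
      using f by (metis atLeastLessThan_iff bij_betw_imp_surj_on imageE)
    with x show "z \<in> (\<Union>i. U i)"
      by (auto simp: U_def)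
  qed
  moreover have "bounded (U i) \<and> diameter (U i) \<le> 2 * e" for i
    using assms by (simp add: U_def)
  ultimately have "hausdorff_premeasure t (2 * e) E \<le> (\<Sum>i. hausdorff_weight t (U i))"
    unfolding hausdorff_premeasure_def by (intro INF_lower) auto
  also have "\<dots> = (\<Sum>i<card F. hausdorff_weight t (U i))"
    by (rule suminf_finite) (auto simp: U_def hausdorff_weight_def)
  also have "\<dots> = ennreal (real (card F) * (unit_ball_vol t * e powr t))"
    using assms by (simp add: U_def hausdorff_weight_cball ennreal_mult ennreal_of_nat_eq_real_of_nat)
  also have "\<dots> \<le> ennreal (unit_ball_vol t * 2 ^ ?d / unit_ball_vol (real ?d)
                   * (e powr t / e ^ ?d) * measure lebesgue T)"
  proof (rule ennreal_leI)
    have "real (card F) * (unit_ball_vol (real ?d) * (e/2) ^ ?d) \<le> measure lebesgue T"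
      using separated_card_le_measure[OF F(2) assms(3) F(3) T(1)] T(2) F(1) by blast
    then have "real (card F) \<le> 2 ^ ?d / unit_ball_vol (real ?d) / e ^ ?d * measure lebesgue T"
      using assms by (simp add: field_simps)
    then have "real (card F) * (unit_ball_vol t * e powr t)
             \<le> (2 ^ ?d / unit_ball_vol (real ?d) / e ^ ?d * measure lebesgue T) * (unit_ball_vol t * e powr t)"
      using assms by (intro mult_right_mono) auto
    then show "real (card F) * (unit_ball_vol t * e powr t)
             \<le> unit_ball_vol t * 2 ^ ?d / unit_ball_vol (real ?d) * (e powr t / e ^ ?d) * measure lebesgue T"
      by (simp add: algebra_simps)
  qed
  finally show ?thesis .
qed

lemma hausdorff_premeasure_antimono:
  "\<delta> \<le> \<delta>' \<Longrightarrow> hausdorff_premeasure t \<delta>' E \<le> hausdorff_premeasure t \<delta> E"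
  unfolding hausdorff_premeasure_def by (rule INF_superset_mono) (auto intro: order_trans)

lemma hausdorff_measure_leI:
  assumes "0 < e0" and "\<And>e. 0 < e \<Longrightarrow> e \<le> e0 \<Longrightarrow> hausdorff_premeasure t (2 * e) E \<le> B"
  shows "hausdorff_measure t E \<le> B"
  unfolding hausdorff_measure_def
proof (rule SUP_least)
  fix \<delta> :: real assume "\<delta> \<in> {0<..}"
  then have "hausdorff_premeasure t (2 * min e0 (\<delta>/2)) E \<le> B"
    using assms(1) by (intro assms(2)) auto
  then show "hausdorff_premeasure t \<delta> E \<le> B"
    by (rule order_trans[OF hausdorff_premeasure_antimono, rotated]) auto
qed

text \<open>A measure is dominated by Hausdorff measure as soon as there is a way \<open>W\<close> of turning
  covers of \<open>E\<close> into covers of \<open>R\<close> that bounds the mass of each piece by the weight of the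
  covering set it comes from. The sets \<open>W U\<close> may fail to be measurable, hence the
  supersets \<open>T\<close>.\<close>

lemma emeasure_le_hausdorff_measure:
  fixes E :: "'a::metric_space set" and W :: "'a set \<Rightarrow> 'b set"
  assumes "0 < \<delta>" and "0 < K"
    and W: "\<And>U. bounded U \<Longrightarrow> diameter U \<le> \<delta> \<Longrightarrow>
              \<exists>T\<in>sets M. W U \<subseteq> T \<and> emeasure M T \<le> ennreal K * hausdorff_weight t U"
    and R: "\<And>U::nat \<Rightarrow> 'a set. E \<subseteq> (\<Union>i. U i) \<Longrightarrow> R \<subseteq> (\<Union>i. W (U i))"
  shows "emeasure M R \<le> ennreal K * hausdorff_measure t E"
proof -
  have "emeasure M R / ennreal K \<le> hausdorff_premeasure t \<delta> E"
    unfolding hausdorff_premeasure_def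
  proof (rule INF_greatest)
    fix U :: "nat \<Rightarrow> 'a set"
    assume "U \<in> {U. E \<subseteq> (\<Union>i. U i) \<and> (\<forall>i. bounded (U i) \<and> diameter (U i) \<le> \<delta>)}"
    then have U: "E \<subseteq> (\<Union>i. U i)" "\<And>i. bounded (U i)" "\<And>i. diameter (U i) \<le> \<delta>"
      by auto
    have "\<forall>i. \<exists>T. T \<in> sets M \<and> W (U i) \<subseteq> T \<and> emeasure M T \<le> ennreal K * hausdorff_weight t (U i)"
      using W[OF U(2,3)] by blast
    then obtain T where T: "\<And>i. T i \<in> sets M" "\<And>i. W (U i) \<subseteq> T i"
      "\<And>i. emeasure M (T i) \<le> ennreal K * hausdorff_weight t (U i)"
      by metis
    have "emeasure M R \<le> emeasure M (\<Union>i. T i)"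
      using R[OF U(1)] T(1,2) by (intro emeasure_mono) (blast, auto)
    also have "\<dots> \<le> (\<Sum>i. emeasure M (T i))"
      using T(1) by (intro emeasure_subadditive_countably) auto
    also have "\<dots> \<le> (\<Sum>i. ennreal K * hausdorff_weight t (U i))"
      by (intro suminf_le T(3)) auto
    also have "\<dots> = ennreal K * (\<Sum>i. hausdorff_weight t (U i))"
      by simp
    finally show "emeasure M R / ennreal K \<le> (\<Sum>i. hausdorff_weight t (U i))"
      using \<open>0 < K\<close> by (intro divide_le_posI_ennreal) auto
  qed
  also have "\<dots> \<le> hausdorff_measure t E"
    unfolding hausdorff_measure_def using \<open>0 < \<delta>\<close> by (intro SUP_upper) auto
  finally have "ennreal K * (emeasure M R / ennreal K) \<le> ennreal K * hausdorff_measure t E"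
    by (rule mult_left_mono) auto
  moreover have "ennreal K * (emeasure M R / ennreal K) = emeasure M R"
    using \<open>0 < K\<close> by (simp add: ennreal_times_divide mult.commute[of "ennreal K"] mult_divide_eq_ennreal)
  ultimately show ?thesis
    by simp
qed

text \<open>A bounded set lies in the ball about any of its points with the diameter as radius. The
  factor \<open>2 ^ DIM('a)\<close> makes up for the weight of a set being the volume of a ball with half
  of that radius.\<close>

lemma measure_le_hausdorff_measure_DIM:
  fixes E :: "'a::euclidean_space set"
  assumes "E \<in> lmeasurable"
  shows "ennreal (measure lebesgue E) \<le> ennreal (2 ^ DIM('a)) * hausdorff_measure (real DIM('a)) E"
proof -
  have "emeasure lebesgue E \<le> ennreal (2 ^ DIM('a)) * hausdorff_measure (real DIM('a)) E"
  proof (rule emeasure_le_hausdorff_measure[where W = "\<lambda>U. U" and \<delta> = 1])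
    fix U :: "'a set" assume U: "bounded U"
    show "\<exists>T\<in>sets lebesgue. U \<subseteq> T \<and>
            emeasure lebesgue T \<le> ennreal (2 ^ DIM('a)) * hausdorff_weight (real DIM('a)) U"
    proof (cases "U = {}")
      case False
      then obtain x where x: "x \<in> U"
        by auto
      have "0 \<le> diameter U"
        using U by (rule diameter_ge_0)
      then have "(diameter U / 2) powr real DIM('a) = (diameter U / 2) ^ DIM('a)"
        by (cases "diameter U = 0") (auto simp: powr_realpow)
      then have "emeasure lebesgue (cball x (diameter U))
          = ennreal (2 ^ DIM('a)) * hausdorff_weight (real DIM('a)) U"
        using False \<open>0 \<le> diameter U\<close>
        by (simp add: hausdorff_weight_def emeasure_cball ennreal_mult[symmetric] power_divide)
      moreover have "U \<subseteq> cball x (diameter U)"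
        using diameter_bounded_bound[OF U x] by auto
      ultimately show ?thesis
        by (intro bexI[of _ "cball x (diameter U)"]) auto
    next
      case True
      then show ?thesis
        by (intro bexI[of _ "{}"]) auto
    qed
  qed auto
  then show ?thesis
    using assms by (simp add: emeasure_eq_measure2)
qed

text \<open>The packing bound applies with the parallel set of radius \<open>r + e/2\<close> as \<open>T\<close>; for \<open>e \<le> r\<close>
  its volume exceeds that of the original one by at most the factor \<open>2 ^ DIM('a)\<close>.\<close>

lemma hausdorff_measure_parallel_set_le:
  fixes A :: "'a::euclidean_space set"
  assumes "bounded A" and "0 < r"
  shows "hausdorff_measure (real DIM('a)) (parallel_set A r)
       \<le> ennreal (4 ^ DIM('a) * measure lebesgue (parallel_set A r))"
proof (rule hausdorff_measure_leI[OF \<open>0 < r\<close>])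
  let ?d = "DIM('a)"
  fix e assume e: "0 < e" "e \<le> r"
  have "hausdorff_premeasure (real ?d) (2 * e) (parallel_set A r)
      \<le> ennreal (unit_ball_vol (real ?d) * 2 ^ ?d / unit_ball_vol (real ?d)
                * (e powr real ?d / e ^ ?d) * measure lebesgue (parallel_set A (r + e/2)))"
  proof (rule hausdorff_premeasure_le_measure)
    fix x assume x: "x \<in> parallel_set A r"
    show "cball x (e/2) \<subseteq> parallel_set A (r + e/2)"
    proof
      fix y assume "y \<in> cball x (e/2)"
      with x show "y \<in> parallel_set A (r + e/2)"
        using infdist_triangle[of y A x] by (simp add: parallel_set_def dist_commute)
    qed
  qed (use assms e in \<open>simp_all add: lmeasurable_parallel_set compact_imp_bounded compact_parallel_set\<close>)
  also have "\<dots> \<le> ennreal (4 ^ ?d * measure lebesgue (parallel_set A r))"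
  proof (rule ennreal_leI)
    have "measure lebesgue (parallel_set A (r + e/2)) \<le> ((r + e/2)/r) ^ ?d * measure lebesgue (parallel_set A r)"
      using assms e by (intro measure_parallel_set_scale) auto
    also have "\<dots> \<le> 2 ^ ?d * measure lebesgue (parallel_set A r)"
      using assms e by (intro mult_right_mono power_mono) (auto simp: field_simps)
    finally have "2 ^ ?d * measure lebesgue (parallel_set A (r + e/2))
        \<le> 2 ^ ?d * (2 ^ ?d * measure lebesgue (parallel_set A r))"
      by (rule mult_left_mono) auto
    also have "\<dots> = 4 ^ ?d * measure lebesgue (parallel_set A r)"
      by (simp add: power_mult_distrib[symmetric])
    finally show "unit_ball_vol (real ?d) * 2 ^ ?d / unit_ball_vol (real ?d)
                * (e powr real ?d / e ^ ?d) * measure lebesgue (parallel_set A (r + e/2))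
              \<le> 4 ^ ?d * measure lebesgue (parallel_set A r)"
      using e by (simp add: powr_realpow less_imp_neq[OF unit_ball_vol_pos, symmetric])
  qed
  finally show "hausdorff_premeasure (real ?d) (2 * e) (parallel_set A r)
      \<le> ennreal (4 ^ ?d * measure lebesgue (parallel_set A r))" .
qed

section \<open>Upper bound for the surface area\<close>

text \<open>Points at distance less than \<open>r\<close> are interior, by continuity of the distance.\<close>

lemma infdist_frontier_parallel_set:
  fixes A :: "'a::euclidean_space set"
  assumes "A \<noteq> {}" and "x \<in> frontier (parallel_set A r)"
  shows "infdist x A = r"
proof (rule antisym)
  have P: "parallel_set A r = {z. infdist z A \<le> r}"
    using assms by (simp add: parallel_set_def)
  have "closed {z. infdist z A \<le> r}"
    by (intro closed_Collect_le continuous_intros)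
  then show "infdist x A \<le> r"
    using assms by (auto simp: P frontier_def)
  have "open {z. infdist z A < r}"
    by (intro open_Collect_less continuous_intros)
  then have "{z. infdist z A < r} \<subseteq> interior {z. infdist z A \<le> r}"
    by (intro interior_maximal) auto
  then show "r \<le> infdist x A"
    using assms by (force simp: P frontier_def)
qed

lemma one_minus_power_le:
  fixes x :: real
  assumes "0 \<le> x"
  shows "1 - x ^ n \<le> real n * (1 - x)"
  using Bernoulli_inequality[of "x - 1" n] assms by (simp add: algebra_simps)

text \<open>Scaling from the inner radius \<open>r - e\<close> to the outer radius \<open>r + e/2\<close> shows that the inner
  parallel set has at least the fraction \<open>((r - e) / (r + e/2)) ^ DIM('a)\<close> of the volume of the
  outer one; Bernoulli's inequality bounds the rest linearly in \<open>e/r\<close>. The factor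
  \<open>2 ^ DIM('a)\<close> comes from replacing the outer radius by \<open>r\<close>.\<close>

lemma measure_annulus_le:
  fixes A :: "'a::euclidean_space set"
  assumes "bounded A" and "0 < e" and "e \<le> r/2"
  shows "measure lebesgue (parallel_set A (r + e/2) - parallel_set A (r - e))
       \<le> 2 * real DIM('a) * 2 ^ DIM('a) * (e/r) * measure lebesgue (parallel_set A r)"
proof -
  let ?d = "DIM('a)"
  let ?V = "\<lambda>s. measure lebesgue (parallel_set A s)"
  define x where "x = (r - e) / (r + e/2)"
  have r: "0 < r"
    using assms by simp
  have x: "0 \<le> x" "1 - x \<le> 2 * (e/r)"
    using assms r by (auto simp: x_def field_simps)
  have "?V (r + e/2) \<le> ((r + e/2)/(r - e)) ^ ?d * ?V (r - e)"
    using assms r by (intro measure_parallel_set_scale) auto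
  then have "x ^ ?d * ?V (r + e/2) \<le> x ^ ?d * (((r + e/2)/(r - e)) ^ ?d * ?V (r - e))"
    using x by (intro mult_left_mono) auto
  also have "\<dots> = ?V (r - e)"
    using assms r by (simp add: x_def power_mult_distrib[symmetric] mult.assoc[symmetric])
  finally have *: "x ^ ?d * ?V (r + e/2) \<le> ?V (r - e)" .
  have "measure lebesgue (parallel_set A (r + e/2) - parallel_set A (r - e)) = ?V (r + e/2) - ?V (r - e)"
    using assms
    by (intro measurable_measure_Diff lmeasurable_parallel_set fmeasurableD parallel_set_mono) auto
  also have "\<dots> \<le> (1 - x ^ ?d) * ?V (r + e/2)"
    using * by (simp add: algebra_simps)
  also have "\<dots> \<le> (real ?d * (2 * (e/r))) * (2 ^ ?d * ?V r)"
  proof (rule mult_mono)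
    show "1 - x ^ ?d \<le> real ?d * (2 * (e/r))"
      using one_minus_power_le[OF x(1), of ?d] mult_left_mono[OF x(2), of "real ?d"] by simp
    have "?V (r + e/2) \<le> ((r + e/2)/r) ^ ?d * ?V r"
      using assms r by (intro measure_parallel_set_scale) auto
    also have "\<dots> \<le> 2 ^ ?d * ?V r"
      using assms r by (intro mult_right_mono power_mono) (auto simp: field_simps)
    finally show "?V (r + e/2) \<le> 2 ^ ?d * ?V r" .
  qed (use assms r in auto)
  finally show ?thesis
    by (simp add: mult_ac)
qed

text \<open>The \<open>e/2\<close>-neighbourhood of the boundary lies in a thin annulus, whose volume is at most a
  multiple of \<open>e/r\<close> times the volume of the parallel set. The inner radius is \<open>r - e\<close> rather
  than \<open>r - e/2\<close> so that points at distance exactly \<open>r - e/2\<close> are kept.\<close>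

lemma parallel_surface_le:
  fixes A :: "'a::euclidean_space set"
  assumes "bounded A" and "A \<noteq> {}" and "0 < r"
  shows "parallel_surface A r
       \<le> ennreal (unit_ball_vol (real DIM('a) - 1) * 2 ^ DIM('a) / unit_ball_vol (real DIM('a))
            * (2 * real DIM('a) * 2 ^ DIM('a)) * measure lebesgue (parallel_set A r) / r)"
  unfolding parallel_surface_def
proof (rule hausdorff_measure_leI)
  show "0 < r/2"
    using assms by simp
  let ?d = "DIM('a)"
  let ?C = "unit_ball_vol (real ?d - 1) * 2 ^ ?d / unit_ball_vol (real ?d)"
  let ?T = "\<lambda>e. parallel_set A (r + e/2) - parallel_set A (r - e)"
  fix e assume e: "0 < e" "e \<le> r/2"
  have "hausdorff_premeasure (real ?d - 1) (2 * e) (frontier (parallel_set A r))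
      \<le> ennreal (?C * (e powr (real ?d - 1) / e ^ ?d) * measure lebesgue (?T e))"
  proof (rule hausdorff_premeasure_le_measure)
    fix x assume "x \<in> frontier (parallel_set A r)"
    then have x: "infdist x A = r"
      using assms by (intro infdist_frontier_parallel_set)
    show "cball x (e/2) \<subseteq> ?T e"
    proof
      fix y assume "y \<in> cball x (e/2)"
      then have "\<bar>infdist y A - r\<bar> \<le> e/2"
        using x infdist_triangle_abs[of y A x] by (simp add: dist_commute)
      then have "infdist y A \<le> r + e/2" "r - e < infdist y A"
        using e unfolding abs_le_iff by linarith+
      then show "y \<in> ?T e"
        using assms by (simp add: parallel_set_def)
    qed
  next
    show "0 \<le> real ?d - 1"
      using DIM_ge_Suc0[where 'a='a] by simp
  qed (use assms e in \<open>auto intro!: fmeasurable_Diff fmeasurableD lmeasurable_parallel_set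
         compact_imp_bounded compact_frontier compact_parallel_set\<close>)
  also have "\<dots> \<le> ennreal (?C * (2 * real ?d * 2 ^ ?d) * measure lebesgue (parallel_set A r) / r)"
  proof (rule ennreal_leI)
    have "e ^ ?d = e * e powr (real ?d - 1)"
      using e by (simp add: powr_mult_base powr_realpow)
    then have "?C * (e powr (real ?d - 1) / e ^ ?d) * measure lebesgue (?T e) = ?C / e * measure lebesgue (?T e)"
      using e by simp
    also have "\<dots> \<le> ?C / e * (2 * real ?d * 2 ^ ?d * (e/r) * measure lebesgue (parallel_set A r))"
      using e assms DIM_ge_Suc0[where 'a='a]
      by (intro mult_left_mono measure_annulus_le divide_nonneg_nonneg mult_nonneg_nonneg unit_ball_vol_nonneg) auto
    finally show "?C * (e powr (real ?d - 1) / e ^ ?d) * measure lebesgue (?T e)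
        \<le> ?C * (2 * real ?d * 2 ^ ?d) * measure lebesgue (parallel_set A r) / r"
      using e by (simp add: mult_ac)
  qed
  finally show "hausdorff_premeasure (real ?d - 1) (2 * e) (frontier (parallel_set A r))
      \<le> ennreal (?C * (2 * real ?d * 2 ^ ?d) * measure lebesgue (parallel_set A r) / r)" .
qed

section \<open>Lifting boundary pieces along rays\<close>

text \<open>Towards a nearest point the distance to the set drops at unit speed, which is the fastest
  that the triangle inequality permits.\<close>

lemma infdist_towards_nearest:
  fixes A :: "'a::euclidean_space set"
  assumes "p \<in> A" and "infdist z A = dist z p" and "0 \<le> t" and "t \<le> 1"
  shows "dist (p + t *\<^sub>R (z - p)) p = t * dist z p"
    and "infdist (p + t *\<^sub>R (z - p)) A = t * dist z p"
proof -
  let ?y = "p + t *\<^sub>R (z - p)"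
  show *: "dist ?y p = t * dist z p"
    using assms by (simp add: dist_norm)
  have "z - ?y = (1 - t) *\<^sub>R (z - p)"
    by (simp add: algebra_simps)
  then have "dist z ?y = (1 - t) * dist z p"
    using assms by (simp add: dist_norm)
  then have "t * dist z p \<le> infdist ?y A"
    using infdist_triangle[of z A ?y] assms by (simp add: algebra_simps)
  moreover have "infdist ?y A \<le> t * dist z p"
    using infdist_le[OF assms(1), of ?y] * by simp
  ultimately show "infdist ?y A = t * dist z p"
    by simp
qed

text \<open>The distance to \<open>A\<close> continues to grow beyond the point of the segment at which it equals
  \<open>r\<close>, because the segment goes on towards \<open>z\<close>; so there are points outside the parallel set
  arbitrarily close by. Without \<open>r < dist z p\<close> this fails: a point where the distance has a
  local maximum is interior to the parallel set.\<close>

lemma ray_point_in_frontier: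
  fixes A :: "'a::euclidean_space set"
  assumes "p \<in> A" and "infdist z A = dist z p" and "0 < r" and "r < dist z p"
  shows "p + (r / dist z p) *\<^sub>R (z - p) \<in> frontier (parallel_set A r)"
proof -
  let ?s = "dist z p"
  let ?q = "p + (r / ?s) *\<^sub>R (z - p)"
  have P: "parallel_set A r = {z. infdist z A \<le> r}"
    using assms by (auto simp: parallel_set_def)
  have "?q \<in> parallel_set A r"
    using infdist_towards_nearest(2)[OF assms(1,2), of "r / ?s"] assms
    by (auto simp: P divide_le_eq_1)
  moreover have "?q \<notin> interior (parallel_set A r)"
  proof
    assume "?q \<in> interior (parallel_set A r)"
    then obtain e where e: "0 < e" "ball ?q e \<subseteq> parallel_set A r"
      by (meson mem_interior)
    \<comment> \<open>A point of the segment past \<open>?q\<close>, but neither past \<open>z\<close> nor outside the ball.\<close>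
    define t where "t = min ?s (r + e/2)"
    have t: "r < t" "t \<le> ?s" "t < r + e"
      using e assms by (auto simp: t_def)
    let ?y = "p + (t / ?s) *\<^sub>R (z - p)"
    have "?y - ?q = ((t - r) / ?s) *\<^sub>R (z - p)"
      by (simp add: algebra_simps diff_divide_distrib)
    then have "dist ?y ?q = t - r"
      using t assms by (auto simp: dist_norm)
    then have "?y \<in> parallel_set A r"
      using e t by (auto simp: dist_commute)
    moreover have "infdist ?y A = t"
      using infdist_towards_nearest(2)[OF assms(1,2), of "t / ?s"] assms t by (auto simp: divide_le_eq_1)
    ultimately show False
      using t by (simp add: P)
  qed
  ultimately show ?thesis
    using closure_subset by (auto simp: frontier_def)
qed

lemma norm_le_norm_add_nonneg_inner:
  fixes u v :: "'a::real_inner"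
  assumes "0 \<le> u \<bullet> v"
  shows "norm u \<le> norm (u + v)"
  using assms by (simp add: norm_le inner_add_left inner_add_right inner_commute)

text \<open>The map from points \<open>z\<close> outside a parallel set to boundary points on the segments to their
  nearest points does not contract too much. If \<open>z\<close> and \<open>y\<close> have the same distance \<open>s\<close>, with
  nearest points \<open>p\<close> and \<open>p'\<close>, the difference of the boundary points is
  \<open>(r/s) *\<^sub>R (z - y) + (1 - r/s) *\<^sub>R (p - p')\<close>, and by monotonicity of nearest points the second
  summand does not shorten the first. Different distances are reduced to this case
  by moving the farther point towards its nearest point.\<close>

lemma dist_le_ray_points:
  fixes A :: "'a::euclidean_space set"
  assumes p: "p \<in> A" "infdist z A = dist z p" and p': "p' \<in> A" "infdist z' A = dist z' p'"
    and r: "0 < r" "r \<le> dist z p" "dist z p \<le> dist z' p'"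
  shows "dist z z' \<le> dist z p / r * dist (p + (r / dist z p) *\<^sub>R (z - p)) (p' + (r / dist z' p') *\<^sub>R (z' - p'))
                    + (dist z' p' - dist z p)"
proof -
  define s s' where "s = dist z p" and "s' = dist z' p'"
  have s: "0 < s" "s \<le> s'" "r \<le> s" "0 < s'"
    using r by (auto simp: s_def s'_def)
  \<comment> \<open>\<open>y\<close> is the point on the second segment that is as far from \<open>A\<close> as \<open>z\<close> is.\<close>
  define y where "y = p' + (s / s') *\<^sub>R (z' - p')"
  define q q' where "q = p + (r / s) *\<^sub>R (z - p)" and "q' = p' + (r / s') *\<^sub>R (z' - p')"
  have y: "dist y p' = s" "infdist y A = s"
    using infdist_towards_nearest[OF p', of "s / s'"] s by (simp_all add: y_def s'_def)
  have "z' - y = (1 - s / s') *\<^sub>R (z' - p')"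
    by (simp add: y_def algebra_simps)
  then have "dist y z' = \<bar>1 - s / s'\<bar> * s'"
    by (simp add: dist_norm norm_minus_commute[of y] s'_def)
  also have "\<dots> = s' - s"
    using s by (simp add: field_simps)
  finally have yz': "dist y z' = s' - s" .
  have "0 \<le> (z - y) \<bullet> (p - p')"
    using infdist_le[OF p'(1), of z] infdist_le[OF p(1), of y] p y
    by (intro nearest_points_monotone) simp_all
  then have "0 \<le> ((r / s) *\<^sub>R (z - y)) \<bullet> ((1 - r / s) *\<^sub>R (p - p'))"
    using s r by simp
  then have "norm ((r / s) *\<^sub>R (z - y)) \<le> norm ((r / s) *\<^sub>R (z - y) + (1 - r / s) *\<^sub>R (p - p'))"
    by (rule norm_le_norm_add_nonneg_inner)
  also have "(r / s) *\<^sub>R (z - y) + (1 - r / s) *\<^sub>R (p - p') = q - q'"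
    using s by (simp add: y_def q_def q'_def algebra_simps)
  finally have "r / s * dist z y \<le> dist q q'"
    using s r by (simp add: dist_norm)
  then have "s / r * (r / s * dist z y) \<le> s / r * dist q q'"
    using s r by (intro mult_left_mono) auto
  then have "dist z y \<le> s / r * dist q q'"
    using s r by simp
  then have "dist z z' \<le> s / r * dist q q' + (s' - s)"
    using dist_triangle[of z z' y] yz' by simp
  then show ?thesis
    by (simp add: s_def s'_def q_def q'_def)
qed

text \<open>The part of the annulus between the radii \<open>r\<close> and \<open>c * r\<close> that lies above \<open>U\<close>. Only those
  points of \<open>U\<close> matter that are interior to a segment from a nearest point; the
  nearest point of such a point is unique, so that its segment is determined up to length.\<close>

definition ray_lift :: "'a::euclidean_space set \<Rightarrow> real \<Rightarrow> real \<Rightarrow> 'a set \<Rightarrow> 'a set" where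
  "ray_lift A r c U = {z. r < infdist z A \<and> infdist z A \<le> c * r \<and>
     (\<exists>p\<in>A. infdist z A = dist z p \<and> p + (r / dist z p) *\<^sub>R (z - p) \<in> U)}"

lemma dist_ray_lift_le:
  assumes "bounded U" and "0 < r"
    and "z \<in> ray_lift A r c U" and "z' \<in> ray_lift A r c U"
  shows "dist z z' \<le> c * diameter U + \<bar>infdist z' A - infdist z A\<bar>"
proof -
  have *: "dist z z' \<le> c * diameter U + \<bar>infdist z' A - infdist z A\<bar>"
    if z: "z \<in> ray_lift A r c U" and z': "z' \<in> ray_lift A r c U"
      and le: "infdist z A \<le> infdist z' A" for z z'
  proof -
    obtain p where p: "p \<in> A" "infdist z A = dist z p" "p + (r / dist z p) *\<^sub>R (z - p) \<in> U"
      and zr: "r < infdist z A" "infdist z A \<le> c * r"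
      using z by (auto simp: ray_lift_def)
    obtain p' where p': "p' \<in> A" "infdist z' A = dist z' p'" "p' + (r / dist z' p') *\<^sub>R (z' - p') \<in> U"
      using z' by (auto simp: ray_lift_def)
    let ?D = "dist (p + (r / dist z p) *\<^sub>R (z - p)) (p' + (r / dist z' p') *\<^sub>R (z' - p'))"
    have "dist z z' \<le> dist z p / r * ?D + (dist z' p' - dist z p)"
      using p p' zr le \<open>0 < r\<close> by (intro dist_le_ray_points[of p A z p' z' r]) auto
    moreover have "0 < c * r"
      using zr \<open>0 < r\<close> by linarith
    then have "0 < c"
      using \<open>0 < r\<close> by (rule zero_less_mult_pos2)
    then have "dist z p / r * ?D \<le> c * diameter U"
      using p p' zr assms diameter_bounded_bound[OF assms(1) p(3) p'(3)]
      by (intro mult_mono) (auto simp: field_simps diameter_ge_0)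
    ultimately show ?thesis
      using p p' by simp
  qed
  show ?thesis
    using *[of z z'] *[of z' z] assms by (cases "infdist z A \<le> infdist z' A") (auto simp: dist_commute)
qed

text \<open>Slicing the lift of \<open>U\<close> by distance into about \<open>(c - 1) * r / e\<close> layers of height \<open>e\<close> gives
  pieces of diameter at most \<open>(c + 1) * e\<close>, each of which fits into one ball. In total the
  volume is of the order \<open>r * e ^ (DIM('a) - 1)\<close>.\<close>

lemma ray_lift_cover:
  fixes A U :: "'a::euclidean_space set"
  assumes "bounded U" and "diameter U \<le> e" and "0 < e" and "e \<le> r" and "1 \<le> c"
  obtains T where "T \<in> lmeasurable" "ray_lift A r c U \<subseteq> T"
    "measure lebesgue T \<le> c * r / e * (unit_ball_vol (real DIM('a)) * ((c + 1) * e) ^ DIM('a))"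
proof -
  \<comment> \<open>\<open>L j\<close> is the layer at height \<open>j * e\<close> above the parallel set; the lift reaches up to height \<open>(c - 1) * r\<close>, hence \<open>n\<close>.\<close>
  define n where "n = Suc (nat \<lfloor>(c - 1) * r / e\<rfloor>)"
  define L where "L j = {z \<in> ray_lift A r c U. nat \<lfloor>(infdist z A - r) / e\<rfloor> = j}" for j
  define B where "B j = cball (SOME z. z \<in> L j) ((c + 1) * e)" for j
  have r: "0 < r"
    using assms by simp
  have L: "dist z z' \<le> (c + 1) * e" if "z \<in> L j" "z' \<in> L j" for z z' j
  proof -
    have *: "real j * e \<le> infdist x A - r \<and> infdist x A - r \<le> real j * e + e" if "x \<in> L j" for x
    proof -
      have "0 \<le> (infdist x A - r) / e"
        using that assms by (auto simp: L_def ray_lift_def)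
      then have "real j \<le> (infdist x A - r) / e" "(infdist x A - r) / e \<le> real j + 1"
        using that by (auto simp: L_def)
      then show ?thesis
        using \<open>0 < e\<close> by (simp add: field_simps)
    qed
    have "\<bar>infdist z' A - infdist z A\<bar> \<le> e"
      using *[OF that(1)] *[OF that(2)] by linarith
    moreover have "c * diameter U \<le> c * e"
      using assms by simp
    moreover have "dist z z' \<le> c * diameter U + \<bar>infdist z' A - infdist z A\<bar>"
      using that assms r by (intro dist_ray_lift_le[of U r]) (auto simp: L_def)
    ultimately show ?thesis
      by (simp add: algebra_simps)
  qed
  have "ray_lift A r c U \<subseteq> (\<Union>j<n. B j)"
  proof
    fix z assume z: "z \<in> ray_lift A r c U"
    define j where "j = nat \<lfloor>(infdist z A - r) / e\<rfloor>"
    have "infdist z A - r \<le> (c - 1) * r"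
      using z by (simp add: ray_lift_def algebra_simps)
    then have "(infdist z A - r) / e \<le> (c - 1) * r / e"
      using \<open>0 < e\<close> by (simp add: divide_right_mono)
    then have "j < n"
      unfolding j_def n_def by (simp add: floor_mono le_imp_less_Suc nat_mono)
    moreover have zj: "z \<in> L j"
      using z by (simp add: L_def j_def)
    then have "z \<in> B j"
      using L[OF someI[of "\<lambda>z. z \<in> L j"]] by (auto simp: B_def)
    ultimately show "z \<in> (\<Union>j<n. B j)"
      by auto
  qed
  moreover have "(\<Union>j<n. B j) \<in> lmeasurable"
    by (auto simp: B_def intro!: lmeasurable_compact compact_UN)
  moreover have "measure lebesgue (\<Union>j<n. B j) \<le> c * r / e * (unit_ball_vol (real DIM('a)) * ((c + 1) * e) ^ DIM('a))"
  proof -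
    have "measure lebesgue (\<Union>j<n. B j) \<le> (\<Sum>j<n. measure lebesgue (B j))"
      by (rule measure_UNION_le) (auto simp: B_def)
    also have "\<dots> = real n * (unit_ball_vol (real DIM('a)) * ((c + 1) * e) ^ DIM('a))"
      using assms by (simp add: B_def measure_lebesgue_cball del: measure_completion)
    also have "\<dots> \<le> c * r / e * (unit_ball_vol (real DIM('a)) * ((c + 1) * e) ^ DIM('a))"
    proof (rule mult_right_mono)
      have "0 \<le> (c - 1) * r / e"
        using assms by simp
      then have "real n \<le> (c - 1) * r / e + 1"
        unfolding n_def by linarith
      also have "\<dots> \<le> (c - 1) * r / e + r / e"
        using assms by simp
      also have "\<dots> = c * r / e"
        using assms by (simp add: field_simps)
      finally show "real n \<le> c * r / e" .
    qed (use assms in simp)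
    finally show ?thesis .
  qed
  ultimately show ?thesis
    using that by blast
qed

text \<open>For \<open>e = diameter U\<close> the volume of the cover is a multiple of \<open>r\<close> times the weight of \<open>U\<close>.
  The scale \<open>e\<close> has to be positive, so sets of diameter zero are treated by letting \<open>e\<close> tend
  to \<open>0\<close>, which shows the lift to be negligible, except in dimension one. There nonempty sets
  have weight \<open>1\<close> whatever their diameter, and any scale, for instance \<open>e = r\<close>, is good.\<close>

lemma ray_lift_volume_le_weight:
  assumes "1 \<le> c"
  obtains K where "0 < K"
    and "\<And>(A :: 'a::euclidean_space set) r U. 0 < r \<Longrightarrow> bounded U \<Longrightarrow> diameter U \<le> r \<Longrightarrow>
      \<exists>T\<in>sets lebesgue. ray_lift A r c U \<subseteq> T \<and>
        emeasure lebesgue T \<le> ennreal (K * r) * hausdorff_weight (real DIM('a) - 1) U"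
proof
  let ?d = "DIM('a)"
  define t where "t = real ?d - 1"
  have t: "0 \<le> t"
    using DIM_ge_Suc0[where 'a='a] by (simp add: t_def)
  define w where "w = unit_ball_vol t"
  have w: "0 < w"
    using t by (simp add: w_def)
  define Q where "Q = c * unit_ball_vol (real ?d) * (c + 1) ^ ?d"
  have Q: "0 < Q"
    using assms by (simp add: Q_def)
  define K where "K = Q * 2 powr t / w"
  show "0 < K"
    using Q w by (simp add: K_def)
  fix A U :: "'a set" and r :: real
  assume r: "0 < r" and U: "bounded U" "diameter U \<le> r"
  have cover: "\<exists>T\<in>lmeasurable. ray_lift A r c U \<subseteq> T \<and> measure lebesgue T \<le> Q * r * e powr t"
    if e: "diameter U \<le> e" "0 < e" "e \<le> r" for e
  proof -
    obtain T where T: "T \<in> lmeasurable" "ray_lift A r c U \<subseteq> T"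
      "measure lebesgue T \<le> c * r / e * (unit_ball_vol (real ?d) * ((c + 1) * e) ^ ?d)"
      using ray_lift_cover[OF U(1) e assms, of A] by blast
    have "e ^ ?d = e * e powr t"
      using e by (simp add: powr_mult_base powr_realpow t_def)
    then have "c * r / e * (unit_ball_vol (real ?d) * ((c + 1) * e) ^ ?d) = Q * r * e powr t"
      using e by (simp add: Q_def power_mult_distrib)
    with T show ?thesis
      by auto
  qed
  have "\<exists>T\<in>sets lebesgue. ray_lift A r c U \<subseteq> T \<and>
      emeasure lebesgue T \<le> ennreal (K * r) * hausdorff_weight t U"
  proof -
    \<comment> \<open>The middle case collects all situations in which some scale \<open>e\<close> makes the volume of the cover a multiple of the weight.\<close>
    consider "U = {}" | e where "U \<noteq> {}" "diameter U \<le> e" "0 < e" "e \<le> r" "t = 0 \<or> e = diameter U"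
      | "U \<noteq> {}" "0 < t" "diameter U = 0"
      using t U r diameter_ge_0[OF U(1)] by (metis order_refl less_eq_real_def)
    then show ?thesis
    proof cases
      case 1
      then show ?thesis
        by (intro bexI[of _ "{}"]) (auto simp: ray_lift_def)
    next
      case (2 e)
      obtain T where T: "T \<in> lmeasurable" "ray_lift A r c U \<subseteq> T" "measure lebesgue T \<le> Q * r * e powr t"
        using cover[of e] 2 by blast
      have "hausdorff_weight t U = ennreal (w * (e / 2) powr t)"
        using 2 by (auto simp: hausdorff_weight_def w_def)
      then have "ennreal (K * r) * hausdorff_weight t U = ennreal (K * r * (w * (e / 2) powr t))"
        using w r \<open>0 < K\<close> by (simp add: ennreal_mult)
      also have "K * r * (w * (e / 2) powr t) = Q * r * e powr t"
        using w 2 by (simp add: K_def powr_divide)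
      finally show ?thesis
        using T by (intro bexI[of _ T]) (auto simp: emeasure_eq_measure2 intro!: ennreal_leI fmeasurableD)
    next
      case 3
      have "negligible (ray_lift A r c U)"
        unfolding negligible_outer
      proof (intro allI impI)
        fix \<eta> :: real assume "0 < \<eta>"
        \<comment> \<open>The second bound solves \<open>Q * r * e powr t = \<eta>/2\<close>; it needs \<open>t > 0\<close>.\<close>
        define e where "e = min r ((\<eta> / (2 * Q * r)) powr (1 / t))"
        have e: "0 < e" "e \<le> r"
          using r Q \<open>0 < \<eta>\<close> by (auto simp: e_def)
        have "e powr t \<le> ((\<eta> / (2 * Q * r)) powr (1 / t)) powr t"
          using e 3 by (intro powr_mono2) (auto simp: e_def)
        also have "\<dots> = \<eta> / (2 * Q * r)"
          using 3 r Q \<open>0 < \<eta>\<close> by (simp add: powr_powr)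
        finally have "Q * r * e powr t \<le> Q * r * (\<eta> / (2 * Q * r))"
          using Q r by (intro mult_left_mono) auto
        also have "\<dots> < \<eta>"
          using Q r \<open>0 < \<eta>\<close> by simp
        finally have "Q * r * e powr t < \<eta>" .
        moreover obtain T where "T \<in> lmeasurable" "ray_lift A r c U \<subseteq> T" "measure lebesgue T \<le> Q * r * e powr t"
          using cover[of e] e 3 by auto
        ultimately show "\<exists>T. ray_lift A r c U \<subseteq> T \<and> T \<in> lmeasurable \<and> measure lebesgue T < \<eta>"
          by (meson le_less_trans)
      qed
      then have "ray_lift A r c U \<in> null_sets lebesgue"
        by (simp add: negligible_iff_null_sets)
      then show ?thesis
        by (intro bexI[of _ "ray_lift A r c U"]) (auto simp: null_setsD1 null_setsD2)
    qed
  qed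
  then show "\<exists>T\<in>sets lebesgue. ray_lift A r c U \<subseteq> T \<and>
      emeasure lebesgue T \<le> ennreal (K * r) * hausdorff_weight (real ?d - 1) U"
    by (simp add: t_def)
qed

section \<open>Lower bound for the surface area\<close>

text \<open>Every point of the annulus has a nearest point in the closure of \<open>A\<close> and therefore lies above
  a boundary point of the parallel set. A cover of the boundary by small sets hence lifts to a
  cover of the annulus.\<close>

lemma volume_increment_le_surface:
  assumes "1 \<le> c"
  obtains K where "0 < K"
    and "\<And>(A :: 'a::euclidean_space set) r. bounded A \<Longrightarrow> A \<noteq> {} \<Longrightarrow> 0 < r \<Longrightarrow>
      ennreal (measure lebesgue (parallel_set A (c * r)) - measure lebesgue (parallel_set A r))
        \<le> ennreal (K * r) * parallel_surface A r"
proof -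
  obtain K where K: "0 < K"
    "\<And>(A :: 'a set) r U. 0 < r \<Longrightarrow> bounded U \<Longrightarrow> diameter U \<le> r \<Longrightarrow>
      \<exists>T\<in>sets lebesgue. ray_lift A r c U \<subseteq> T \<and>
        emeasure lebesgue T \<le> ennreal (K * r) * hausdorff_weight (real DIM('a) - 1) U"
    using ray_lift_volume_le_weight[OF assms, where 'a='a] by metis
  have "ennreal (measure lebesgue (parallel_set A (c * r)) - measure lebesgue (parallel_set A r))
        \<le> ennreal (K * r) * parallel_surface A r"
    if A: "bounded A" "A \<noteq> {}" and r: "0 < r" for A :: "'a set" and r
  proof -
    define R where "R = parallel_set A (c * r) - parallel_set A r"
    have R_meas: "R \<in> lmeasurable"
      using A by (auto simp: R_def intro!: fmeasurable_Diff fmeasurableD lmeasurable_parallel_set)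
    have "r \<le> c * r"
      using assms r by simp
    then have "measure lebesgue R = measure lebesgue (parallel_set A (c * r)) - measure lebesgue (parallel_set A r)"
      unfolding R_def using A
      by (intro measurable_measure_Diff lmeasurable_parallel_set fmeasurableD parallel_set_mono)
    then have "ennreal (measure lebesgue (parallel_set A (c * r)) - measure lebesgue (parallel_set A r))
        = emeasure lebesgue R"
      using R_meas by (simp add: emeasure_eq_measure2)
    also have "\<dots> \<le> ennreal (K * r) * parallel_surface A r"
      unfolding parallel_surface_def
    proof (rule emeasure_le_hausdorff_measure[where \<delta> = r and W = "ray_lift (closure A) r c"])
      fix U :: "nat \<Rightarrow> 'a set"
      assume U: "frontier (parallel_set A r) \<subseteq> (\<Union>i. U i)"
      show "R \<subseteq> (\<Union>i. ray_lift (closure A) r c (U i))"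
      proof
        fix z assume "z \<in> R"
        then have z: "r < infdist z (closure A)" "infdist z (closure A) \<le> c * r"
          using A by (auto simp: R_def parallel_set_def)
        obtain p where p: "p \<in> closure A" "infdist z (closure A) = dist z p"
          using infdist_attains_inf[of "closure A" z] A by auto
        then have "p + (r / dist z p) *\<^sub>R (z - p) \<in> frontier (parallel_set (closure A) r)"
          using z r by (intro ray_point_in_frontier) auto
        then have "p + (r / dist z p) *\<^sub>R (z - p) \<in> (\<Union>i. U i)"
          using U by (auto simp: parallel_set_closure)
        then show "z \<in> (\<Union>i. ray_lift (closure A) r c (U i))"
          using z p unfolding ray_lift_def by blast
      qed
    qed (use K r in auto)
    finally show ?thesis .
  qed
  with K(1) that show ?thesis
    by blast
qed

section \<open>Contents as asymptotic inequalities\<close>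

lemma ereal_le_enn2ereal_divide_iff:
  "0 < k \<Longrightarrow> 0 \<le> m \<Longrightarrow> ereal m \<le> enn2ereal x / ereal k \<longleftrightarrow> ennreal (m * k) \<le> x"
  by (cases x) (auto simp: field_simps ennreal_le_iff2)

lemma enn2ereal_divide_le_ereal_iff:
  "0 < k \<Longrightarrow> 0 \<le> m \<Longrightarrow> enn2ereal x / ereal k \<le> ereal m \<longleftrightarrow> x \<le> ennreal (m * k)"
  by (cases x) (auto simp: field_simps top_unique ennreal_le_iff)

lemma Liminf_enn2ereal_divide_pos_iff:
  assumes "eventually (\<lambda>x. 0 < k x) F"
  shows "0 < Liminf F (\<lambda>x. enn2ereal (f x) / ereal (k x))
    \<longleftrightarrow> (\<exists>m>0. eventually (\<lambda>x. ennreal (m * k x) \<le> f x) F)"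
proof
  assume "0 < Liminf F (\<lambda>x. enn2ereal (f x) / ereal (k x))"
  then obtain m where m: "0 < ereal m" "ereal m < Liminf F (\<lambda>x. enn2ereal (f x) / ereal (k x))"
    using ereal_dense2 by blast
  have "eventually (\<lambda>x. ennreal (m * k x) \<le> f x) F"
    using assms less_LiminfD[OF m(2)]
  proof eventually_elim
    case (elim x)
    then show ?case
      using m ereal_le_enn2ereal_divide_iff[of "k x" m "f x"] by (simp add: less_imp_le)
  qed
  with m show "\<exists>m>0. eventually (\<lambda>x. ennreal (m * k x) \<le> f x) F"
    by auto
next
  assume "\<exists>m>0. eventually (\<lambda>x. ennreal (m * k x) \<le> f x) F"
  then obtain m where m: "0 < m" "eventually (\<lambda>x. ennreal (m * k x) \<le> f x) F"
    by blast
  have "ereal m \<le> Liminf F (\<lambda>x. enn2ereal (f x) / ereal (k x))"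
  proof (rule Liminf_bounded)
    show "eventually (\<lambda>x. ereal m \<le> enn2ereal (f x) / ereal (k x)) F"
      using assms m(2) by eventually_elim (use m(1) in \<open>simp add: ereal_le_enn2ereal_divide_iff\<close>)
  qed
  with m(1) show "0 < Liminf F (\<lambda>x. enn2ereal (f x) / ereal (k x))"
    by (auto intro: less_le_trans[of _ "ereal m"])
qed

lemma Limsup_enn2ereal_divide_finite_iff:
  assumes "eventually (\<lambda>x. 0 < k x) F"
  shows "Limsup F (\<lambda>x. enn2ereal (f x) / ereal (k x)) < \<infinity>
    \<longleftrightarrow> (\<exists>m>0. eventually (\<lambda>x. f x \<le> ennreal (m * k x)) F)"
proof
  assume "Limsup F (\<lambda>x. enn2ereal (f x) / ereal (k x)) < \<infinity>"
  then have "max 0 (Limsup F (\<lambda>x. enn2ereal (f x) / ereal (k x))) < \<infinity>"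
    by (simp add: max_def)
  then obtain m where "max 0 (Limsup F (\<lambda>x. enn2ereal (f x) / ereal (k x))) < ereal m"
    using ereal_dense2 by blast
  then have m: "0 < m" "Limsup F (\<lambda>x. enn2ereal (f x) / ereal (k x)) < ereal m"
    by auto
  have "eventually (\<lambda>x. f x \<le> ennreal (m * k x)) F"
    using assms Limsup_lessD[OF m(2)]
  proof eventually_elim
    case (elim x)
    then show ?case
      using m enn2ereal_divide_le_ereal_iff[of "k x" m "f x"] by (simp add: less_imp_le)
  qed
  with m show "\<exists>m>0. eventually (\<lambda>x. f x \<le> ennreal (m * k x)) F"
    by auto
next
  assume "\<exists>m>0. eventually (\<lambda>x. f x \<le> ennreal (m * k x)) F"
  then obtain m where m: "0 < m" "eventually (\<lambda>x. f x \<le> ennreal (m * k x)) F"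
    by blast
  have "Limsup F (\<lambda>x. enn2ereal (f x) / ereal (k x)) \<le> ereal m"
  proof (rule Limsup_bounded)
    show "eventually (\<lambda>x. enn2ereal (f x) / ereal (k x) \<le> ereal m) F"
      using assms m(2) by eventually_elim (use m(1) in \<open>simp add: enn2ereal_divide_le_ereal_iff\<close>)
  qed
  then show "Limsup F (\<lambda>x. enn2ereal (f x) / ereal (k x)) < \<infinity>"
    by (auto intro: le_less_trans[of _ "ereal m"])
qed

lemma lower_S_content_le_upper: "lower_S_content k A \<le> upper_S_content k A"
  unfolding lower_S_content_def upper_S_content_def by (rule Liminf_le_Limsup) simp

text \<open>Positivity and finiteness of S-contents only depend on the order of magnitude of the
  denominator.\<close>

lemma S_contents_comparable:
  assumes k: "eventually (\<lambda>r. 0 < k r) (at_right 0)"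
    and ab: "0 < a" "0 < b" "eventually (\<lambda>r. a * k r \<le> l r \<and> l r \<le> b * k r) (at_right 0)"
    and S: "0 < lower_S_content k A" "upper_S_content k A < \<infinity>"
  shows "0 < lower_S_content l A" and "upper_S_content l A < \<infinity>"
proof -
  have l: "eventually (\<lambda>r. 0 < l r) (at_right 0)"
    using k ab(3) by eventually_elim (use ab(1) in \<open>auto intro: less_le_trans[OF mult_pos_pos]\<close>)
  obtain m where m: "0 < m" "eventually (\<lambda>r. ennreal (m * k r) \<le> parallel_surface A r) (at_right 0)"
    using S(1) Liminf_enn2ereal_divide_pos_iff[OF k] by (auto simp: lower_S_content_def)
  obtain M where M: "0 < M" "eventually (\<lambda>r. parallel_surface A r \<le> ennreal (M * k r)) (at_right 0)"
    using S(2) Limsup_enn2ereal_divide_finite_iff[OF k] by (auto simp: upper_S_content_def)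
  have "eventually (\<lambda>r. ennreal (m / b * l r) \<le> parallel_surface A r) (at_right 0)"
    using ab(3) m(2)
  proof eventually_elim
    case (elim r)
    have "m / b * l r \<le> m / b * (b * k r)"
      using elim m ab by (intro mult_left_mono) auto
    then show ?case
      using elim ab by (auto intro: order_trans[OF ennreal_leI])
  qed
  then show "0 < lower_S_content l A"
    unfolding lower_S_content_def Liminf_enn2ereal_divide_pos_iff[OF l]
    using m ab by (intro exI[of _ "m / b"]) auto
  have "eventually (\<lambda>r. parallel_surface A r \<le> ennreal (M / a * l r)) (at_right 0)"
    using ab(3) M(2)
  proof eventually_elim
    case (elim r)
    have "M / a * (a * k r) \<le> M / a * l r"
      using elim M ab by (intro mult_left_mono) auto
    then show ?case
      using elim ab by (auto intro: order_trans[OF _ ennreal_leI])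
  qed
  then show "upper_S_content l A < \<infinity>"
    unfolding upper_S_content_def Limsup_enn2ereal_divide_finite_iff[OF l]
    using M ab by (intro exI[of _ "M / a"]) auto
qed

text \<open>The upper bound is immediate from the bound of the surface area by a multiple of \<open>V r / r\<close>. For the lower
  bound the factor \<open>c\<close> is chosen so large that the growth of \<open>h\<close> forces
  \<open>V (c * r) \<ge> 2 * M * h r\<close>, whereas \<open>V r \<le> M * h r\<close>; the difference \<open>M * h r\<close> is then paid for by
  the surface area. Here \<open>V\<close> is the Lebesgue measure of the parallel set.\<close>

lemma S_contents_inverse_mult:
  fixes A :: "'a::euclidean_space set" and h :: "real \<Rightarrow> real"
  assumes "bounded A" and h: "\<And>r. 0 < r \<Longrightarrow> 0 < h r" and "0 < \<alpha>"
    and growth: "\<And>c r. 1 \<le> c \<Longrightarrow> 0 < r \<Longrightarrow> c powr \<alpha> * h r \<le> h (c * r)"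
    and m: "0 < m" "eventually (\<lambda>r. m * h r \<le> measure lebesgue (parallel_set A r)) (at_right 0)"
    and M: "0 < M" "eventually (\<lambda>r. measure lebesgue (parallel_set A r) \<le> M * h r) (at_right 0)"
  shows "0 < lower_S_content (\<lambda>r. inverse r * h r) A"
    and "upper_S_content (\<lambda>r. inverse r * h r) A < \<infinity>"
proof -
  let ?V = "\<lambda>r. measure lebesgue (parallel_set A r)"
  have k: "eventually (\<lambda>r. 0 < inverse r * h r) (at_right 0)"
    using eventually_at_right_less by eventually_elim (simp add: h)
  obtain b where b: "0 < b" "\<And>r. 0 < r \<Longrightarrow> r < b \<Longrightarrow> m * h r \<le> ?V r \<and> ?V r \<le> M * h r"
    using eventually_conj[OF m(2) M(2)] unfolding eventually_at_right_field by auto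
  have "A \<noteq> {}"
  proof
    assume "A = {}"
    then have "m * h (b/2) \<le> 0"
      using b(2)[of "b/2"] b(1) by (simp add: parallel_set_def)
    with m(1) h[of "b/2"] b(1) show False
      by (simp add: mult_le_0_iff)
  qed
  show "upper_S_content (\<lambda>r. inverse r * h r) A < \<infinity>"
  proof -
    define C where "C = unit_ball_vol (real DIM('a) - 1) * 2 ^ DIM('a) / unit_ball_vol (real DIM('a))
            * (2 * real DIM('a) * 2 ^ DIM('a))"
    have C: "0 < C"
      using DIM_ge_Suc0[where 'a='a] by (simp add: C_def)
    have "parallel_surface A r \<le> ennreal (C * M * (inverse r * h r))" if "0 < r" "r < b" for r
    proof -
      have "parallel_surface A r \<le> ennreal (C * ?V r / r)"
        using parallel_surface_le[OF assms(1) \<open>A \<noteq> {}\<close> that(1)] by (simp add: C_def)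
      also have "C * ?V r / r \<le> C * (M * h r) / r"
        using C that b(2)[OF that] by (intro divide_right_mono mult_left_mono) auto
      finally show ?thesis
        using that by (simp add: field_simps ennreal_leI)
    qed
    then show ?thesis
      unfolding upper_S_content_def Limsup_enn2ereal_divide_finite_iff[OF k]
      using C M b(1) by (intro exI[of _ "C * M"]) (auto simp: eventually_at_right_field)
  qed
  show "0 < lower_S_content (\<lambda>r. inverse r * h r) A"
  proof -
    define c where "c = max 1 ((2 * M / m) powr (1 / \<alpha>))"
    have c: "1 \<le> c"
      by (simp add: c_def)
    have "((2 * M / m) powr (1 / \<alpha>)) powr \<alpha> \<le> c powr \<alpha>"
      using \<open>0 < \<alpha>\<close> by (intro powr_mono2) (auto simp: c_def)
    then have c_large: "2 * M \<le> m * c powr \<alpha>"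
      using \<open>0 < \<alpha>\<close> m(1) M(1) by (simp add: powr_powr field_simps)
    obtain K where K: "0 < K" "\<And>(A :: 'a set) r. bounded A \<Longrightarrow> A \<noteq> {} \<Longrightarrow> 0 < r \<Longrightarrow>
      ennreal (measure lebesgue (parallel_set A (c * r)) - measure lebesgue (parallel_set A r))
        \<le> ennreal (K * r) * parallel_surface A r"
      using volume_increment_le_surface[OF c, where 'a='a] by metis
    have "ennreal (M / K * (inverse r * h r)) \<le> parallel_surface A r" if r: "0 < r" "r < b / c" for r
    proof -
      have cr: "0 < c * r" "c * r < b" "r \<le> c * r"
        using c r by (auto simp: field_simps)
      have "2 * M * h r \<le> m * c powr \<alpha> * h r"
        using c_large h[OF r(1)] by (intro mult_right_mono) auto
      also have "\<dots> \<le> m * h (c * r)"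
        using growth[OF c r(1)] m(1) by (simp add: mult.assoc)
      also have "\<dots> \<le> ?V (c * r)"
        using b(2)[of "c * r"] cr by simp
      finally have "M * h r \<le> ?V (c * r) - ?V r"
        using b(2)[of r] cr r by simp
      then have "ennreal (M * h r) \<le> ennreal (K * r) * parallel_surface A r"
        by (rule order_trans[OF ennreal_leI K(2)[OF assms(1) \<open>A \<noteq> {}\<close> r(1)]])
      then have "ennreal (M * h r) / ennreal (K * r) \<le> parallel_surface A r"
        using K(1) r by (intro divide_le_posI_ennreal) auto
      then show ?thesis
        using K(1) r M(1) h[OF r(1)] by (simp add: divide_ennreal field_simps)
    qed
    then show ?thesis
      unfolding lower_S_content_def Liminf_enn2ereal_divide_pos_iff[OF k]
      using M K(1) b(1) c
      by (intro exI[of _ "M / K"]) (auto simp: eventually_at_right_field intro!: exI[of _ "b / c"])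
  qed
qed

text \<open>By the product rule \<open>r * deriv h r / h r = \<alpha> + r * deriv g r / g r\<close>. The last summand is
  nonnegative by monotonicity of \<open>g\<close> and bounded above by the assumption on the upper limit.\<close>

lemma eventually_deriv_powr_mult_bounds:
  fixes h g :: "real \<Rightarrow> real"
  assumes h: "\<And>r. 0 < r \<Longrightarrow> h r = r powr \<alpha> * g r" and g: "\<And>r. 0 < r \<Longrightarrow> 0 < g r"
    and mono: "mono_on {0<..} g" and diff: "\<And>r. 0 < r \<Longrightarrow> g differentiable at r"
    and limsup: "Limsup (at_right 0) (\<lambda>r. ereal (r * deriv g r / g r)) < \<infinity>" and "0 < \<alpha>"
  obtains b where "0 < b"
    "eventually (\<lambda>r. \<alpha> * (inverse r * h r) \<le> deriv h r \<and> deriv h r \<le> b * (inverse r * h r)) (at_right 0)"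
proof -
  have "max 0 (Limsup (at_right 0) (\<lambda>r. ereal (r * deriv g r / g r))) < \<infinity>"
    using limsup by (simp add: max_def)
  then obtain B where "max 0 (Limsup (at_right 0) (\<lambda>r. ereal (r * deriv g r / g r))) < ereal B"
    using ereal_dense2 by blast
  then have B: "0 < B" "Limsup (at_right 0) (\<lambda>r. ereal (r * deriv g r / g r)) < ereal B"
    by auto
  have "eventually (\<lambda>r. \<alpha> * (inverse r * h r) \<le> deriv h r \<and> deriv h r \<le> (\<alpha> + B) * (inverse r * h r)) (at_right 0)"
    using eventually_at_right_less[of 0] Limsup_lessD[OF B(2)]
  proof eventually_elim
    case (elim r)
    then have r: "0 < r" and Br: "r * deriv g r / g r < B"
      by auto
    have g': "(g has_real_derivative deriv g r) (at r)"
      using diff[OF r] by (simp add: DERIV_deriv_iff_real_differentiable)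
    have "0 \<le> deriv g r"
      by (rule mono_on_imp_deriv_nonneg[OF mono g']) (use r in \<open>simp add: interior_open\<close>)
    then have nonneg: "0 \<le> r * deriv g r / g r"
      using r g[OF r] by simp
    have "((\<lambda>x. x powr \<alpha> * g x) has_real_derivative
        \<alpha> * r powr (\<alpha> - 1) * g r + deriv g r * r powr \<alpha>) (at r)"
      using r by (auto intro!: derivative_eq_intros g')
    moreover have "\<alpha> * r powr (\<alpha> - 1) * g r + deriv g r * r powr \<alpha>
        = (\<alpha> + r * deriv g r / g r) * (inverse r * h r)"
      using r g[OF r] by (simp add: h powr_diff field_simps)
    ultimately have "((\<lambda>x. x powr \<alpha> * g x) has_real_derivative
        (\<alpha> + r * deriv g r / g r) * (inverse r * h r)) (at r)"
      by simp
    then have "(h has_real_derivative (\<alpha> + r * deriv g r / g r) * (inverse r * h r)) (at r)"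
      by (rule has_field_derivative_transform_within_open[where S = "{0<..}"]) (use r h in auto)
    then have "deriv h r = (\<alpha> + r * deriv g r / g r) * (inverse r * h r)"
      by (rule DERIV_imp_deriv)
    moreover have "0 < inverse r * h r"
      using r g[OF r] by (simp add: h)
    ultimately show ?case
      using nonneg Br by (simp add: mult_right_mono)
  qed
  with that[of "\<alpha> + B"] B(1) \<open>0 < \<alpha>\<close> show ?thesis
    by simp
qed

theorem theorem3p4:
  fixes A :: "'a::euclidean_space set" and h g :: "real \<Rightarrow> real" and D :: real
  assumes "bounded A"
    and "gauge_function h"
    and "0 \<le> D" and "D < real DIM('a)"
    and "\<forall>r>0. g r > 0" and "mono_on {0<..} g"
    and "\<forall>r>0. h r = r powr (real DIM('a) - D) * g r"
    and "0 < lower_Minkowski_content h A"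
    and "lower_Minkowski_content h A \<le> upper_Minkowski_content h A"
    and "upper_Minkowski_content h A < \<infinity>"
  shows "(0 < lower_S_content (\<lambda>r. inverse r * h r) A
        \<and> lower_S_content (\<lambda>r. inverse r * h r) A \<le> upper_S_content (\<lambda>r. inverse r * h r) A
        \<and> upper_S_content (\<lambda>r. inverse r * h r) A < \<infinity>)
    \<and> ((\<forall>r>0. g differentiable at r)
        \<and> Limsup (at_right 0) (\<lambda>r. ereal (r * deriv g r / g r)) < \<infinity>
      \<longrightarrow> 0 < lower_S_content (deriv h) A
        \<and> lower_S_content (deriv h) A \<le> upper_S_content (deriv h) A
        \<and> upper_S_content (deriv h) A < \<infinity>)"
proof -
  let ?V = "\<lambda>r. measure lebesgue (parallel_set A r)"
  define \<alpha> where "\<alpha> = real DIM('a) - D"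
  have \<alpha>: "0 < \<alpha>"
    using assms(4) by (simp add: \<alpha>_def)
  have g: "0 < g r" and h: "h r = r powr \<alpha> * g r" "0 < h r" if "0 < r" for r
    using assms(5,7) that by (auto simp: \<alpha>_def)
  have hpos: "eventually (\<lambda>r. 0 < h r) (at_right 0)"
    using eventually_at_right_less[of 0] by eventually_elim (rule h(2))
  obtain m where m: "0 < m" "eventually (\<lambda>r. ennreal (m * h r) \<le> parallel_volume A r) (at_right 0)"
    using assms(8) Liminf_enn2ereal_divide_pos_iff[OF hpos] by (auto simp: lower_Minkowski_content_def)
  obtain M where M: "0 < M" "eventually (\<lambda>r. parallel_volume A r \<le> ennreal (M * h r)) (at_right 0)"
    using assms(10) Limsup_enn2ereal_divide_finite_iff[OF hpos] by (auto simp: upper_Minkowski_content_def)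
  have V_lower: "eventually (\<lambda>r. m / 4 ^ DIM('a) * h r \<le> ?V r) (at_right 0)"
    using m(2) eventually_at_right_less[of 0]
  proof eventually_elim
    case (elim r)
    then have "ennreal (m * h r) \<le> ennreal (4 ^ DIM('a) * ?V r)"
      unfolding parallel_volume_def
      using hausdorff_measure_parallel_set_le[OF assms(1) elim(2)] by (metis order_trans)
    then show ?case
      by (simp add: field_simps ennreal_le_iff)
  qed
  have V_upper: "eventually (\<lambda>r. ?V r \<le> 2 ^ DIM('a) * M * h r) (at_right 0)"
    using M(2) hpos
  proof eventually_elim
    case (elim r)
    have "ennreal (?V r) \<le> ennreal (2 ^ DIM('a)) * parallel_volume A r"
      unfolding parallel_volume_def
      by (intro measure_le_hausdorff_measure_DIM lmeasurable_parallel_set assms(1))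
    also have "\<dots> \<le> ennreal (2 ^ DIM('a)) * ennreal (M * h r)"
      using elim by (intro mult_left_mono) auto
    also have "\<dots> = ennreal (2 ^ DIM('a) * M * h r)"
      using elim M(1) by (simp add: ennreal_mult[symmetric] mult.assoc)
    finally show ?case
      using elim M(1) by (simp add: ennreal_le_iff)
  qed
  have growth: "c powr \<alpha> * h r \<le> h (c * r)" if "1 \<le> c" "0 < r" for c r
  proof -
    have cr: "0 < c * r" "r \<le> c * r"
      using that by auto
    have "g r \<le> g (c * r)"
      using mono_onD[OF assms(6)] cr that by simp
    then show ?thesis
      using that h(1)[OF that(2)] h(1)[OF cr(1)] by (simp add: powr_mult mult.assoc mult_left_mono)
  qed
  note S = S_contents_inverse_mult[OF assms(1) h(2) \<alpha> growth _ V_lower _ V_upper]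
  have S1: "0 < lower_S_content (\<lambda>r. inverse r * h r) A" "upper_S_content (\<lambda>r. inverse r * h r) A < \<infinity>"
    using S m(1) M(1) by simp_all
  have S2: "0 < lower_S_content (deriv h) A \<and> upper_S_content (deriv h) A < \<infinity>"
    if dg: "\<forall>r>0. g differentiable at r" "Limsup (at_right 0) (\<lambda>r. ereal (r * deriv g r / g r)) < \<infinity>"
  proof -
    obtain b where b: "0 < b"
      "eventually (\<lambda>r. \<alpha> * (inverse r * h r) \<le> deriv h r \<and> deriv h r \<le> b * (inverse r * h r)) (at_right 0)"
      using eventually_deriv_powr_mult_bounds[OF h(1) g assms(6) dg(1)[rule_format] dg(2) \<alpha>] by blast
    have "eventually (\<lambda>r. 0 < inverse r * h r) (at_right 0)"
      using eventually_at_right_less[of 0] by eventually_elim (simp add: h(2))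
    from S_contents_comparable[OF this \<alpha> b S1] show ?thesis
      by simp
  qed
  show ?thesis
    using S1 S2 lower_S_content_le_upper by blast
qed

end
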